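(* Let $\Gamma$ be a finitely generated group and let $R(\Gamma)$ be its finite residual. Let $\nu\colon\mathbb{R}_{>0}\times\mathbb{N}\to\mathbb{N}\cup\{0,\infty\}$ be monotone non-decreasing in the first argument. Then $\Gamma$ is BS-rigid if and only if $\Gamma/R(\Gamma)$ is BS-rigid; and $\Gamma$ is $\nu$-flexibly BS-rigid if and only if $\Gamma/R(\Gamma)$ is $\nu$-flexibly BS-rigid.
   Context: The finite residual $R(\Gamma)$ is the intersection of all finite-index subgroups of $\Gamma$. Write $[n]=\{1,\dots,n\}$ and $\mathrm{Sym}(n)$ for the symmetric group on $[n]$. For $\sigma\in\mathrm{Sym}(n)$ and $\tau\in\mathrm{Sym}(N)$ with $N\ge n$, $d(\sigma,\tau)=d(\tau,\sigma)=\frac1n|\{x\in[n]\mid\sigma x\neq\tau x\}|$. For $f\colon\Gamma\to\mathrm{Sym}(n)$ and finite $Q\subset\Gamma$, $N_{f,Q}$ is the distribution on $2^Q$ of $\{\gamma\in Q\mid f(\gamma)x=x\}$ with $x$ uniform in $[n]$; $d_{\mathrm{TV}}$ is total variation distance (half the $\ell^1$ distance). A group $\Gamma$ is $\nu$-flexibly BS-rigid if for every sequence of functions $(f_\ell\colon\Gamma\to\mathrm{Sym}(n_\ell))_{\ell=1}^\infty$ with $n_\ell\to\infty$ and $d(f_\ell(\gamma_1\gamma_2),f_\ell(\gamma_1)f_\ell(\gamma_2))\to0$ for all $\gamma_1,\gamma_2\in\Gamma$: if there is a sequence of homomorphisms $(g_\ell\colon\Gamma\to\mathrm{Sym}(n_\ell))_{\ell=1}^\infty$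 with $d_{\mathrm{TV}}(N_{f_\ell,Q},N_{g_\ell,Q})\to0$ for every finite $Q\subset\Gamma$, then there are positive reals $\varepsilon_\ell\to0$ and homomorphisms $(h_\ell\colon\Gamma\to\mathrm{Sym}(N_\ell))_{\ell=1}^\infty$ with $n_\ell\le N_\ell\le n_\ell+\nu(\varepsilon_\ell,n_\ell)$ such that $d(f_\ell(\gamma),h_\ell(\gamma))\to0$ for all $\gamma\in\Gamma$. BS-rigid means $\nu$-flexibly BS-rigid with $\nu=0$. *)

theory Defs
  imports
    "HOL-Algebra.Sym_Groups"
    "HOL-Algebra.Generated_Groups"
    "HOL-Library.Extended_Nat"
    "HOL-Probability.Probability_Mass_Function"
begin

definition finitely_generated_group :: "('a, 'b) monoid_scheme \<Rightarrow> bool" where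
  "finitely_generated_group G \<longleftrightarrow>
     (\<exists>S. finite S \<and> S \<subseteq> carrier G \<and> generate G S = carrier G)"

definition finite_residual :: "('a, 'b) monoid_scheme \<Rightarrow> 'a set" where
  "finite_residual G = \<Inter>{H. subgroup H G \<and> finite (rcosets\<^bsub>G\<^esub> H)}"

text \<open>The first argument is the size of the smaller of the two symmetric groups: it is used for
  permutations of \<open>{1..n}\<close> and \<open>{1..N}\<close> with \<open>n \<le> N\<close>, in either order.\<close>

definition perm_dist :: "nat \<Rightarrow> (nat \<Rightarrow> nat) \<Rightarrow> (nat \<Rightarrow> nat) \<Rightarrow> real" where
  "perm_dist n \<sigma> \<tau> = real (card {x \<in> {1..n}. \<sigma> x \<noteq> \<tau> x}) / real n"

text \<open>Only meaningful for \<open>n \<ge> 1\<close>, since \<open>pmf_of_set\<close> is unspecified on the empty set.\<close>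

definition stabilizer_stats ::
    "nat \<Rightarrow> ('a \<Rightarrow> nat \<Rightarrow> nat) \<Rightarrow> 'a set \<Rightarrow> 'a set pmf" where
  "stabilizer_stats n f Q = map_pmf (\<lambda>x. {\<gamma> \<in> Q. f \<gamma> x = x}) (pmf_of_set {1..n})"

definition tv_dist_on :: "'a set \<Rightarrow> 'a pmf \<Rightarrow> 'a pmf \<Rightarrow> real" where
  "tv_dist_on \<Omega> p q = (\<Sum>A\<in>\<Omega>. \<bar>pmf p A - pmf q A\<bar>) / 2"

definition asymptotic_hom ::
    "('a, 'b) monoid_scheme \<Rightarrow> (nat \<Rightarrow> nat) \<Rightarrow> (nat \<Rightarrow> 'a \<Rightarrow> nat \<Rightarrow> nat) \<Rightarrow> bool" where
  "asymptotic_hom G n f \<longleftrightarrow>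
     (\<forall>l. f l \<in> carrier G \<rightarrow> carrier (sym_group (n l))) \<and>
     filterlim n at_top sequentially \<and>
     (\<forall>\<gamma>1\<in>carrier G. \<forall>\<gamma>2\<in>carrier G.
        (\<lambda>l. perm_dist (n l) (f l (\<gamma>1 \<otimes>\<^bsub>G\<^esub> \<gamma>2))
                            (f l \<gamma>1 \<otimes>\<^bsub>sym_group (n l)\<^esub> f l \<gamma>2)) \<longlonglongrightarrow> 0)"

text \<open>Sequences are indexed by all of \<open>nat\<close> rather than from 1, and the degrees \<open>n l\<close> are positive.
  The parameter \<open>\<nu>\<close> has domain \<open>{0<..} \<times> {1..}\<close>; its values elsewhere are never used.\<close>

definition flexibly_BS_rigid ::
    "(real \<Rightarrow> nat \<Rightarrow> enat) \<Rightarrow> ('a, 'b) monoid_scheme \<Rightarrow> bool" where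
  "flexibly_BS_rigid \<nu> G \<longleftrightarrow>
     (\<forall>n f. (\<forall>l. n l \<ge> 1) \<and> asymptotic_hom G n f \<and>
        (\<exists>g. (\<forall>l. g l \<in> hom G (sym_group (n l))) \<and>
             (\<forall>Q. finite Q \<and> Q \<subseteq> carrier G \<longrightarrow>
                (\<lambda>l. tv_dist_on (Pow Q) (stabilizer_stats (n l) (f l) Q)
                                        (stabilizer_stats (n l) (g l) Q)) \<longlonglongrightarrow> 0)) \<longrightarrow>
        (\<exists>\<epsilon> N h. (\<forall>l. \<epsilon> l > 0) \<and> \<epsilon> \<longlonglongrightarrow> 0 \<and>
             (\<forall>l. h l \<in> hom G (sym_group (N l))) \<and>
             (\<forall>l. n l \<le> N l \<and> enat (N l) \<le> enat (n l) + \<nu> (\<epsilon> l) (n l)) \<and>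
             (\<forall>\<gamma>\<in>carrier G. (\<lambda>l. perm_dist (n l) (f l \<gamma>) (h l \<gamma>)) \<longlonglongrightarrow> 0)))"

definition BS_rigid :: "('a, 'b) monoid_scheme \<Rightarrow> bool" where
  "BS_rigid G \<longleftrightarrow> flexibly_BS_rigid (\<lambda>_ _. 0) G"

end

theory Submission
  imports Defs
begin

text \<open>Every homomorphism to a finite symmetric group kills \<open>R = R(\<Gamma>)\<close>, so \<open>\<Gamma>\<close> and \<open>\<Gamma>/R\<close> have the
  same homomorphisms to \<open>Sym(n)\<close>. Asymptotic homomorphisms of \<open>\<Gamma>/R\<close> pull back along the projection.
  Conversely, if the stabilizer statistics of \<open>f\<close> approach those of homomorphisms, then \<open>f(r)\<close>
  approaches the identity for every \<open>r \<in> R\<close>, so composing \<open>f\<close> with a set-theoretic section of the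
  projection gives an asymptotic homomorphism of \<open>\<Gamma>/R\<close> from which \<open>f\<close> is recovered up to a vanishing
  error. Both compositions only relabel stabilizer statistics, which cannot increase total
  variation.\<close>

section \<open>The distance between permutations\<close>

lemma perm_dist_nonneg: "0 \<le> perm_dist n \<sigma> \<tau>"
  by (simp add: perm_dist_def)

text \<open>The three maps are total functions compared on \<open>{1..n}\<close>, so the last one
  may later be a permutation of a larger \<open>{1..N}\<close>, as flexible rigidity allows.\<close>

lemma perm_dist_triangle: "perm_dist n \<sigma> \<rho> \<le> perm_dist n \<sigma> \<tau> + perm_dist n \<tau> \<rho>"
proof -
  have "card {x \<in> {1..n}. \<sigma> x \<noteq> \<rho> x}
      \<le> card ({x \<in> {1..n}. \<sigma> x \<noteq> \<tau> x} \<union> {x \<in> {1..n}. \<tau> x \<noteq> \<rho> x})"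
    by (rule card_mono) auto
  also have "\<dots> \<le> card {x \<in> {1..n}. \<sigma> x \<noteq> \<tau> x} + card {x \<in> {1..n}. \<tau> x \<noteq> \<rho> x}"
    by (rule card_Un_le)
  finally show ?thesis
    unfolding perm_dist_def add_divide_distrib [symmetric]
    by (intro divide_right_mono) simp_all
qed

text \<open>The bijection \<open>\<rho>\<close> carries the points where the composites differ onto
  those where \<open>\<sigma>\<close> and \<open>\<tau>\<close> differ. This later cancels the
  common factor \<open>f l b\<close> from \<open>f l r \<circ> f l b\<close> and
  \<open>f l b\<close>.\<close>

lemma perm_dist_comp_right:
  assumes "\<rho> permutes {1..n}"
  shows "perm_dist n (\<sigma> \<circ> \<rho>) (\<tau> \<circ> \<rho>) = perm_dist n \<sigma> \<tau>"
proof -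
  have inj: "inj \<rho>"
    using assms by (rule permutes_inj)
  have "\<rho> ` {x \<in> {1..n}. \<sigma> (\<rho> x) \<noteq> \<tau> (\<rho> x)} = {x \<in> {1..n}. \<sigma> x \<noteq> \<tau> x}" (is "\<rho> ` ?A = ?B")
  proof
    show "\<rho> ` ?A \<subseteq> ?B"
      using permutes_in_image [OF assms] by auto
    show "?B \<subseteq> \<rho> ` ?A"
    proof
      fix y assume "y \<in> ?B"
      moreover obtain x where "y = \<rho> x"
        using permutes_surj [OF assms] by (metis surjD)
      ultimately show "y \<in> \<rho> ` ?A"
        using permutes_in_image [OF assms] by auto
    qed
  qed
  moreover have "card (\<rho> ` ?A) = card ?A"
    by (intro card_image inj_on_subset [OF inj]) simp
  ultimately show ?thesis
    by (simp add: perm_dist_def)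
qed

lemma perm_dist_tendsto_trans:
  assumes "(\<lambda>l. perm_dist (n l) (\<sigma> l) (\<tau> l)) \<longlonglongrightarrow> 0"
    and "(\<lambda>l. perm_dist (n l) (\<tau> l) (\<rho> l)) \<longlonglongrightarrow> 0"
  shows "(\<lambda>l. perm_dist (n l) (\<sigma> l) (\<rho> l)) \<longlonglongrightarrow> 0"
  by (rule tendsto_sandwich [OF _ _ tendsto_const tendsto_add_zero [OF assms]])
    (auto simp: perm_dist_nonneg perm_dist_triangle)

section \<open>Stabilizer statistics\<close>

lemma pmf_map_pmf_eq_sum:
  assumes "finite \<Omega>" "set_pmf p \<subseteq> \<Omega>"
  shows "pmf (map_pmf F p) A = (\<Sum>B\<in>{B \<in> \<Omega>. F B = A}. pmf p B)"
proof -
  \<comment> \<open>The fibre of \<open>F\<close> over \<open>A\<close> may leave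
    \<open>\<Omega>\<close>; cutting it down to the finite set \<open>\<Omega>\<close> discards only
    points of mass 0.\<close>
  have "measure p (F -` {A}) = measure p {B \<in> \<Omega>. F B = A}"
    using assms(2) by (intro measure_prob_cong_0) (auto simp: set_pmf_iff)
  also have "\<dots> = (\<Sum>B\<in>{B \<in> \<Omega>. F B = A}. pmf p B)"
    using assms(1) by (intro measure_measure_pmf_finite) simp
  finally show ?thesis
    by (simp add: pmf_map)
qed

text \<open>Data processing: a pushforward merges the atoms in each fibre of \<open>F\<close>, and
  the triangle inequality inside a fibre can only shrink the sum.\<close>

lemma tv_dist_on_map_pmf_le:
  assumes "finite \<Omega>" "finite \<Omega>'" "set_pmf p \<subseteq> \<Omega>" "set_pmf q \<subseteq> \<Omega>" "F ` \<Omega> \<subseteq> \<Omega>'"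
  shows "tv_dist_on \<Omega>' (map_pmf F p) (map_pmf F q) \<le> tv_dist_on \<Omega> p q"
proof -
  have "(\<Sum>A\<in>\<Omega>'. \<bar>pmf (map_pmf F p) A - pmf (map_pmf F q) A\<bar>)
      = (\<Sum>A\<in>\<Omega>'. \<bar>\<Sum>B\<in>{B \<in> \<Omega>. F B = A}. pmf p B - pmf q B\<bar>)"
    using assms by (simp add: pmf_map_pmf_eq_sum sum_subtractf)
  also have "\<dots> \<le> (\<Sum>A\<in>\<Omega>'. \<Sum>B\<in>{B \<in> \<Omega>. F B = A}. \<bar>pmf p B - pmf q B\<bar>)"
    by (intro sum_mono sum_abs)
  \<comment> \<open>Since \<open>F\<close> maps \<open>\<Omega>\<close> into
    \<open>\<Omega>'\<close>, its fibres over \<open>\<Omega>'\<close> partition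
    \<open>\<Omega>\<close>.\<close>
  also have "\<dots> = (\<Sum>B\<in>\<Omega>. \<bar>pmf p B - pmf q B\<bar>)"
    using assms by (intro sum.group) auto
  finally show ?thesis
    by (simp add: tv_dist_on_def)
qed

lemma set_pmf_stabilizer_stats: "set_pmf (stabilizer_stats n f Q) \<subseteq> Pow Q"
  by (auto simp: stabilizer_stats_def)

lemma stabilizer_stats_comp:
  "stabilizer_stats n (\<lambda>c. f (u c)) Q
     = map_pmf (\<lambda>A. {c \<in> Q. u c \<in> A}) (stabilizer_stats n f (u ` Q))"
  unfolding stabilizer_stats_def map_pmf_comp
  by (rule map_pmf_cong) auto

lemma tv_dist_on_stabilizer_stats_comp_le:
  assumes "finite Q"
  shows "tv_dist_on (Pow Q) (stabilizer_stats n (\<lambda>c. f (u c)) Q) (stabilizer_stats n (\<lambda>c. g (u c)) Q)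
    \<le> tv_dist_on (Pow (u ` Q)) (stabilizer_stats n f (u ` Q)) (stabilizer_stats n g (u ` Q))"
  unfolding stabilizer_stats_comp [of n _ u]
  using assms by (intro tv_dist_on_map_pmf_le set_pmf_stabilizer_stats) auto

lemma tv_dist_on_nonneg: "0 \<le> tv_dist_on \<Omega> p q"
  by (simp add: tv_dist_on_def sum_nonneg)

lemma tendsto_tv_dist_on_stabilizer_stats_comp:
  assumes "finite Q"
    and "(\<lambda>l. tv_dist_on (Pow (u ` Q)) (stabilizer_stats (n l) (f l) (u ` Q))
                                       (stabilizer_stats (n l) (g l) (u ` Q))) \<longlonglongrightarrow> 0"
  shows "(\<lambda>l. tv_dist_on (Pow Q) (stabilizer_stats (n l) (\<lambda>c. f l (u c)) Q)
                                 (stabilizer_stats (n l) (\<lambda>c. g l (u c)) Q)) \<longlonglongrightarrow> 0"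
  by (rule tendsto_sandwich [OF _ _ tendsto_const assms(2)])
    (auto simp: tv_dist_on_nonneg tv_dist_on_stabilizer_stats_comp_le [OF assms(1)])

lemma pmf_stabilizer_stats_singleton:
  assumes "1 \<le> n"
  shows "pmf (stabilizer_stats n f {\<gamma>}) {\<gamma>} = 1 - perm_dist n (f \<gamma>) id"
proof -
  have ne: "{1..n} \<noteq> {}"
    using assms by simp
  have "pmf (stabilizer_stats n f {\<gamma>}) {\<gamma>} = measure (pmf_of_set {1..n}) {x. f \<gamma> x = x}"
    unfolding stabilizer_stats_def pmf_map by (rule arg_cong [where f = "measure _"]) auto
  also have "\<dots> = card ({1..n} \<inter> {x. f \<gamma> x = x}) / n"
    using ne by (subst measure_pmf_of_set) simp_all
  also have "{1..n} \<inter> {x. f \<gamma> x = x} = {1..n} - {x \<in> {1..n}. f \<gamma> x \<noteq> x}"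
    by auto
  also have "card \<dots> = n - card {x \<in> {1..n}. f \<gamma> x \<noteq> x}"
    by (subst card_Diff_subset) auto
  also have "real \<dots> = n - real (card {x \<in> {1..n}. f \<gamma> x \<noteq> x})"
    using card_mono [of "{1..n}" "{x \<in> {1..n}. f \<gamma> x \<noteq> x}"]
    by (intro of_nat_diff) (simp add: subset_iff)
  finally show ?thesis
    using assms by (simp add: perm_dist_def diff_divide_distrib)
qed

text \<open>The atom \<open>{\<gamma>}\<close> is the event that \<open>\<gamma>\<close> fixes the
  random point: it has mass 1 for \<open>g\<close>, and for \<open>f\<close> it falls short of 1 by
  the distance to \<open>id\<close>. The factor 2 undoes the half in the total variation
  distance.\<close>

lemma perm_dist_id_le_tv_dist_on:
  assumes "1 \<le> n" "g \<gamma> = id"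
  shows "perm_dist n (f \<gamma>) id
    \<le> 2 * tv_dist_on (Pow {\<gamma>}) (stabilizer_stats n f {\<gamma>}) (stabilizer_stats n g {\<gamma>})"
proof -
  have "perm_dist n (f \<gamma>) id
      = \<bar>pmf (stabilizer_stats n f {\<gamma>}) {\<gamma>} - pmf (stabilizer_stats n g {\<gamma>}) {\<gamma>}\<bar>"
    using assms by (simp add: pmf_stabilizer_stats_singleton perm_dist_nonneg)
      (simp add: perm_dist_def)
  also have "\<dots> \<le> (\<Sum>A\<in>Pow {\<gamma>}. \<bar>pmf (stabilizer_stats n f {\<gamma>}) A
                                - pmf (stabilizer_stats n g {\<gamma>}) A\<bar>)"
    by (rule member_le_sum) auto
  finally show ?thesis
    by (simp add: tv_dist_on_def)
qed

section \<open>The finite residual\<close>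

text \<open>Here \<open>K\<close> is the conjugate of \<open>H\<close> by \<open>inv g\<close>. It
  serves to show that the finite residual is normal.\<close>

lemma (in group) conjugate_subgroup_finite_index:
  assumes "subgroup H G" "finite (rcosets H)" "g \<in> carrier G"
  defines "K \<equiv> {x \<in> carrier G. g \<otimes> x \<otimes> inv g \<in> H}"
  shows "subgroup K G" "finite (rcosets K)"
proof -
  interpret H: subgroup H G
    by fact
  have cancel: "inv g \<otimes> (g \<otimes> x) = x" if "x \<in> carrier G" for x
    using that assms(3) by (simp add: m_assoc [symmetric])
  have conj: "g \<otimes> (x \<otimes> y) \<otimes> inv g = (g \<otimes> x \<otimes> inv g) \<otimes> (g \<otimes> y \<otimes> inv g)"
    if "x \<in> carrier G" "y \<in> carrier G" for x y
    using that assms(3) by (simp add: m_assoc cancel)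
  have conj_inv: "g \<otimes> inv x \<otimes> inv g = inv (g \<otimes> x \<otimes> inv g)" if "x \<in> carrier G" for x
    using that assms(3) by (simp add: inv_mult_group m_assoc)
  show K: "subgroup K G"
    by (rule subgroupI) (use assms(3) in \<open>auto simp: K_def conj conj_inv intro!: exI [of _ \<one>]\<close>)
  \<comment> \<open>Each coset \<open>K #> a\<close> is the preimage of
    \<open>H #> (g \<otimes> a)\<close> under left translation by \<open>g\<close>, so
    \<open>K\<close> has at most as many cosets as \<open>H\<close>.\<close>
  have "rcosets K \<subseteq> (\<lambda>C. {x \<in> carrier G. g \<otimes> x \<in> C}) ` (rcosets H)"
  proof
    fix C assume "C \<in> rcosets K"
    then obtain a where a: "a \<in> carrier G" "C = K #> a"
      by (auto simp: RCOSETS_def)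
    have "x \<in> K #> a \<longleftrightarrow> g \<otimes> x \<in> H #> (g \<otimes> a)" if "x \<in> carrier G" for x
    proof -
      have "x \<in> K #> a \<longleftrightarrow> x \<otimes> inv a \<in> K"
        using that a subgroup.rcos_module [OF K is_group] by auto
      also have "\<dots> \<longleftrightarrow> (g \<otimes> x) \<otimes> inv (g \<otimes> a) \<in> H"
        using that a assms(3) by (simp add: K_def inv_mult_group m_assoc)
      also have "\<dots> \<longleftrightarrow> g \<otimes> x \<in> H #> (g \<otimes> a)"
        using that a assms(3) H.rcos_module [OF is_group] by auto
      finally show ?thesis .
    qed
    moreover have "K #> a \<subseteq> carrier G"
      using a K by (simp add: r_coset_subset_G subgroup.subset)
    ultimately have "C = {x \<in> carrier G. g \<otimes> x \<in> H #> (g \<otimes> a)}"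
      using a by auto
    then show "C \<in> (\<lambda>C. {x \<in> carrier G. g \<otimes> x \<in> C}) ` (rcosets H)"
      using a assms(3) by (auto simp: RCOSETS_def)
  qed
  then show "finite (rcosets K)"
    using assms(2) finite_surj by blast
qed

lemma (in group) finite_residual_subset:
  assumes "subgroup H G" "finite (rcosets H)"
  shows "finite_residual G \<subseteq> H"
  using assms by (auto simp: finite_residual_def)

lemma (in group) finite_residual_normal: "finite_residual G \<lhd> G"
proof -
  \<comment> \<open>The whole group has index 1, so the family being intersected is nonempty and its
    intersection is a subgroup.\<close>
  have "subgroup (carrier G) G" "finite (rcosets (carrier G))"
  proof -
    show "subgroup (carrier G) G"
      by (rule subgroup_self)
    have "rcosets (carrier G) \<subseteq> {carrier G}"
      by (auto simp: RCOSETS_def coset_join2 [OF _ subgroup_self])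
    then show "finite (rcosets (carrier G))"
      using finite_subset by blast
  qed
  then have "subgroup (finite_residual G) G"
    unfolding finite_residual_def by (intro subgroups_Inter) auto
  moreover have "g \<otimes> r \<otimes> inv g \<in> finite_residual G"
    if "g \<in> carrier G" "r \<in> finite_residual G" for g r
    unfolding finite_residual_def
  proof clarify
    fix H assume "subgroup H G" "finite (rcosets H)"
    \<comment> \<open>An element of the residual lies in every finite-index subgroup, in particular
      in this conjugate of \<open>H\<close>.\<close>
    then have "finite_residual G \<subseteq> {x \<in> carrier G. g \<otimes> x \<otimes> inv g \<in> H}"
      using that(1) by (intro finite_residual_subset conjugate_subgroup_finite_index)
    then show "g \<otimes> r \<otimes> inv g \<in> H"
      using that(2) by auto
  qed
  ultimately show ?thesis
    by (simp add: normal_inv_iff)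
qed

text \<open>The quotient by the kernel embeds in the finite group \<open>K\<close>, so the kernel
  has finite index and contains the residual.\<close>

lemma (in group) hom_finite_residual:
  assumes "group K" "finite (carrier K)" "h \<in> hom G K" "r \<in> finite_residual G"
  shows "h r = \<one>\<^bsub>K\<^esub>"
proof -
  interpret h: group_hom G K h
    using assms by (simp add: group_hom_def group_hom_axioms_def is_group)
  have "finite (carrier (G Mod kernel G K h))"
    by (rule inj_on_finite [OF h.FactGroup_inj_on _ assms(2)])
      (use h.FactGroup_the_elem_mem in auto)
  then have "finite_residual G \<subseteq> kernel G K h"
    by (intro finite_residual_subset h.subgroup_kernel) (simp add: FactGroup_def)
  then show ?thesis
    using assms(4) by (auto simp: kernel_def)
qed

lemma finite_carrier_sym_group: "finite (carrier (sym_group n))"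
  by (simp add: sym_group_def finite_permutations)

section \<open>A section of the quotient map\<close>

text \<open>An arbitrary set-theoretic section of the quotient map, in general not a homomorphism;
  it is multiplicative only up to elements of \<open>H\<close>.\<close>

definition coset_rep :: "'a set \<Rightarrow> 'a" where
  "coset_rep C = (SOME x. x \<in> C)"

context normal
begin

lemma coset_rep:
  assumes "C \<in> carrier (G Mod H)"
  shows "coset_rep C \<in> carrier G" "H #> coset_rep C = C"
proof -
  obtain a where a: "a \<in> carrier G" "C = H #> a"
    using assms by (auto simp: FactGroup_def RCOSETS_def)
  then have "a \<in> C"
    using rcos_self [OF _ is_subgroup] by simp
  then have "coset_rep C \<in> C"
    unfolding coset_rep_def by (rule someI)
  then show "coset_rep C \<in> carrier G" "H #> coset_rep C = C"
    using a r_coset_subset_G [OF subset, of a] repr_independence [OF _ _ is_subgroup] by auto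
qed

lemma r_coset_in_FactGroup: "a \<in> carrier G \<Longrightarrow> H #> a \<in> carrier (G Mod H)"
  by (auto simp: FactGroup_def RCOSETS_def)

lemma r_coset_coset_rep_mult:
  assumes "C \<in> carrier (G Mod H)" "D \<in> carrier (G Mod H)"
  shows "H #> coset_rep (C \<otimes>\<^bsub>G Mod H\<^esub> D) = H #> (coset_rep C \<otimes> coset_rep D)"
proof -
  interpret Q: group "G Mod H"
    by (rule factorgroup_is_group)
  show ?thesis
    using assms hom_mult [OF r_coset_hom_Mod, of "coset_rep C" "coset_rep D"]
      coset_rep(2) [OF Q.m_closed [OF assms]]
    by (simp add: coset_rep)
qed

lemma r_coset_eqE:
  assumes "H #> a = H #> b" "a \<in> carrier G" "b \<in> carrier G"
  obtains r where "r \<in> H" "a = r \<otimes> b"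
proof -
  have "a \<in> H #> b"
    using assms rcos_self [OF _ is_subgroup] by metis
  then show thesis
    using that by (auto simp: r_coset_def)
qed

lemma hom_eq_of_r_coset_eq:
  assumes "group K" "h \<in> hom G K" "\<And>r. r \<in> H \<Longrightarrow> h r = \<one>\<^bsub>K\<^esub>"
    and "H #> a = H #> b" "a \<in> carrier G" "b \<in> carrier G"
  shows "h a = h b"
proof -
  interpret K: group K
    by fact
  obtain r where "r \<in> H" "a = r \<otimes> b"
    using assms(4-6) by (rule r_coset_eqE)
  then show ?thesis
    using assms hom_in_carrier [OF assms(2)] by (simp add: hom_mult)
qed

text \<open>The failure of \<open>coset_rep\<close> to be multiplicative lies in \<open>H\<close>,
  which \<open>h\<close> kills.\<close>

lemma hom_comp_coset_rep:
  assumes "group K" "h \<in> hom G K" "\<And>r. r \<in> H \<Longrightarrow> h r = \<one>\<^bsub>K\<^esub>"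
  shows "(\<lambda>C. h (coset_rep C)) \<in> hom (G Mod H) K"
proof (rule homI)
  interpret Q: group "G Mod H"
    by (rule factorgroup_is_group)
  fix C D assume CD: "C \<in> carrier (G Mod H)" "D \<in> carrier (G Mod H)"
  show "h (coset_rep C) \<in> carrier K"
    using CD assms(2) by (simp add: coset_rep hom_in_carrier)
  have "h (coset_rep (C \<otimes>\<^bsub>G Mod H\<^esub> D)) = h (coset_rep C \<otimes> coset_rep D)"
    using CD by (intro hom_eq_of_r_coset_eq [OF assms] r_coset_coset_rep_mult)
      (simp_all only: coset_rep Q.m_closed m_closed)
  then show "h (coset_rep (C \<otimes>\<^bsub>G Mod H\<^esub> D)) = h (coset_rep C) \<otimes>\<^bsub>K\<^esub> h (coset_rep D)"
    using CD assms(2) by (simp add: coset_rep hom_mult)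
qed

text \<open>The quotient map is an exact homomorphism, so the multiplicative defect of the composite
  at a pair is that of \<open>f\<close> at the pair of cosets.\<close>

lemma asymptotic_hom_comp_r_coset:
  assumes "asymptotic_hom (G Mod H) n f"
  shows "asymptotic_hom G n (\<lambda>l \<gamma>. f l (H #> \<gamma>))"
  using assms hom_mult [OF r_coset_hom_Mod]
  by (auto simp: asymptotic_hom_def r_coset_in_FactGroup Pi_iff)

text \<open>Write \<open>a = r \<otimes> b\<close> with \<open>r\<close> in \<open>H\<close>. Then
  \<open>f l a\<close> is close to \<open>f l r \<circ> f l b\<close>, which is as far from
  \<open>f l b\<close> as \<open>f l r\<close> is from \<open>id\<close>.\<close>

lemma asymptotic_hom_r_coset_eq:
  assumes f: "asymptotic_hom G n f"
    and triv: "\<And>r. r \<in> H \<Longrightarrow> (\<lambda>l. perm_dist (n l) (f l r) id) \<longlonglongrightarrow> 0"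
    and "H #> a = H #> b" "a \<in> carrier G" "b \<in> carrier G"
  shows "(\<lambda>l. perm_dist (n l) (f l a) (f l b)) \<longlonglongrightarrow> 0"
proof -
  obtain r where r: "r \<in> H" "a = r \<otimes> b"
    using assms(3-5) by (rule r_coset_eqE)
  have perm: "f l b permutes {1..n l}" for l
    using f assms(5) by (auto simp: asymptotic_hom_def sym_group_def)
  have "(\<lambda>l. perm_dist (n l) (f l a) (f l r \<circ> f l b)) \<longlonglongrightarrow> 0"
    using f r assms(5) mem_carrier [OF r(1)] by (auto simp: asymptotic_hom_def sym_group_def)
  moreover have "perm_dist (n l) (f l r \<circ> f l b) (f l b) = perm_dist (n l) (f l r) id" for l
    using perm_dist_comp_right [OF perm, of l "f l r" id] by simp
  then have "(\<lambda>l. perm_dist (n l) (f l r \<circ> f l b) (f l b)) \<longlonglongrightarrow> 0"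
    using triv [OF r(1)] by simp
  ultimately show ?thesis
    by (rule perm_dist_tendsto_trans)
qed

text \<open>The representative of a product and the product of the representatives share a coset, so
  \<open>f\<close> nearly agrees on them; asymptotic multiplicativity of \<open>f\<close> does the
  rest.\<close>

lemma asymptotic_hom_comp_coset_rep:
  assumes f: "asymptotic_hom G n f"
    and triv: "\<And>r. r \<in> H \<Longrightarrow> (\<lambda>l. perm_dist (n l) (f l r) id) \<longlonglongrightarrow> 0"
  shows "asymptotic_hom (G Mod H) n (\<lambda>l C. f l (coset_rep C))"
proof -
  interpret Q: group "G Mod H"
    by (rule factorgroup_is_group)
  have "(\<lambda>l. perm_dist (n l) (f l (coset_rep (C \<otimes>\<^bsub>G Mod H\<^esub> D)))
          (f l (coset_rep C) \<otimes>\<^bsub>sym_group (n l)\<^esub> f l (coset_rep D))) \<longlonglongrightarrow> 0"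
    if CD: "C \<in> carrier (G Mod H)" "D \<in> carrier (G Mod H)" for C D
  proof (rule perm_dist_tendsto_trans)
    show "(\<lambda>l. perm_dist (n l) (f l (coset_rep (C \<otimes>\<^bsub>G Mod H\<^esub> D)))
             (f l (coset_rep C \<otimes> coset_rep D))) \<longlonglongrightarrow> 0"
      using CD by (intro asymptotic_hom_r_coset_eq [OF assms] r_coset_coset_rep_mult)
        (simp_all only: coset_rep Q.m_closed m_closed)
    show "(\<lambda>l. perm_dist (n l) (f l (coset_rep C \<otimes> coset_rep D))
             (f l (coset_rep C) \<otimes>\<^bsub>sym_group (n l)\<^esub> f l (coset_rep D))) \<longlonglongrightarrow> 0"
      using CD f by (simp add: asymptotic_hom_def coset_rep)
  qed
  then show ?thesis
    using f by (auto simp: asymptotic_hom_def coset_rep Pi_iff)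
qed

end

section \<open>Rigidity and the quotient by the finite residual\<close>

lemma flexibly_BS_rigidD:
  assumes "flexibly_BS_rigid \<nu> G" "\<And>l. 1 \<le> n l" "asymptotic_hom G n f"
    and "\<And>l. g l \<in> hom G (sym_group (n l))"
    and "\<And>Q. finite Q \<Longrightarrow> Q \<subseteq> carrier G \<Longrightarrow>
           (\<lambda>l. tv_dist_on (Pow Q) (stabilizer_stats (n l) (f l) Q)
                                   (stabilizer_stats (n l) (g l) Q)) \<longlonglongrightarrow> 0"
  obtains \<epsilon> N h where "\<And>l. 0 < \<epsilon> l" "\<epsilon> \<longlonglongrightarrow> 0" "\<And>l. h l \<in> hom G (sym_group (N l))"
    "\<And>l. n l \<le> N l" "\<And>l. enat (N l) \<le> enat (n l) + \<nu> (\<epsilon> l) (n l)"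
    "\<And>\<gamma>. \<gamma> \<in> carrier G \<Longrightarrow> (\<lambda>l. perm_dist (n l) (f l \<gamma>) (h l \<gamma>)) \<longlonglongrightarrow> 0"
proof -
  have "\<exists>\<epsilon> N h. (\<forall>l. \<epsilon> l > 0) \<and> \<epsilon> \<longlonglongrightarrow> 0 \<and>
      (\<forall>l. h l \<in> hom G (sym_group (N l))) \<and>
      (\<forall>l. n l \<le> N l \<and> enat (N l) \<le> enat (n l) + \<nu> (\<epsilon> l) (n l)) \<and>
      (\<forall>\<gamma>\<in>carrier G. (\<lambda>l. perm_dist (n l) (f l \<gamma>) (h l \<gamma>)) \<longlonglongrightarrow> 0)"
    by (rule assms(1) [unfolded flexibly_BS_rigid_def, rule_format]) (use assms(2-5) in blast)
  then show thesis
    using that by blast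
qed

text \<open>Maps are only composed with the quotient map or its section, while \<open>n\<close>,
  \<open>\<epsilon>\<close> and \<open>N\<close> stay the same; hence the bound through
  \<open>\<nu>\<close> carries over verbatim.\<close>

lemma (in group) flexibly_BS_rigid_Mod_finite_residual_iff:
  "flexibly_BS_rigid \<nu> G \<longleftrightarrow> flexibly_BS_rigid \<nu> (G Mod finite_residual G)"
proof -
  define R where "R = finite_residual G"
  interpret R: normal R G
    unfolding R_def by (rule finite_residual_normal)
  \<comment> \<open>With \<open>descend\<close> and \<open>lift\<close>, this moves homomorphisms
    between \<open>G\<close> and the quotient in any degree \<open>m\<close>; it is applied both to
    the given \<open>g l\<close> of degree \<open>n l\<close> and to the resulting
    \<open>h l\<close> of degree \<open>N l\<close>.\<close>
  have kill: "h r = \<one>\<^bsub>sym_group m\<^esub>" if "h \<in> hom G (sym_group m)" "r \<in> R" for h r m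
    using hom_finite_residual [OF sym_group_is_group finite_carrier_sym_group that(1)] that(2)
    by (simp only: R_def)
  have descend: "(\<lambda>C. h (coset_rep C)) \<in> hom (G Mod R) (sym_group m)"
    if "h \<in> hom G (sym_group m)" for h m
    by (rule R.hom_comp_coset_rep [OF sym_group_is_group that kill [OF that]])
  have lift: "(\<lambda>\<gamma>. h (R #> \<gamma>)) \<in> hom G (sym_group m)"
    if "h \<in> hom (G Mod R) (sym_group m)" for h m
    using Group.hom_compose [OF R.r_coset_hom_Mod that] by (simp add: comp_def)
  show ?thesis
    unfolding R_def [symmetric]
  proof
    assume rigid: "flexibly_BS_rigid \<nu> G"
    show "flexibly_BS_rigid \<nu> (G Mod R)"
      unfolding flexibly_BS_rigid_def
    proof (intro allI impI, elim conjE exE)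
      fix n f g
      assume n: "\<forall>l. 1 \<le> n l" and f: "asymptotic_hom (G Mod R) n f"
        and g: "\<forall>l. g l \<in> hom (G Mod R) (sym_group (n l))"
        and tv: "\<forall>Q. finite Q \<and> Q \<subseteq> carrier (G Mod R) \<longrightarrow>
            (\<lambda>l. tv_dist_on (Pow Q) (stabilizer_stats (n l) (f l) Q)
                                    (stabilizer_stats (n l) (g l) Q)) \<longlonglongrightarrow> 0"
      show "\<exists>\<epsilon> N h. (\<forall>l. \<epsilon> l > 0) \<and> \<epsilon> \<longlonglongrightarrow> 0 \<and>
          (\<forall>l. h l \<in> hom (G Mod R) (sym_group (N l))) \<and>
          (\<forall>l. n l \<le> N l \<and> enat (N l) \<le> enat (n l) + \<nu> (\<epsilon> l) (n l)) \<and>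
          (\<forall>C\<in>carrier (G Mod R). (\<lambda>l. perm_dist (n l) (f l C) (h l C)) \<longlonglongrightarrow> 0)"
      proof (rule flexibly_BS_rigidD [OF rigid])
        show "1 \<le> n l" for l
          using n by simp
        show "asymptotic_hom G n (\<lambda>l \<gamma>. f l (R #> \<gamma>))"
          by (rule R.asymptotic_hom_comp_r_coset [OF f])
        show "(\<lambda>\<gamma>. g l (R #> \<gamma>)) \<in> hom G (sym_group (n l))" for l
          using g by (intro lift) simp
        show "(\<lambda>l. tv_dist_on (Pow Q) (stabilizer_stats (n l) (\<lambda>\<gamma>. f l (R #> \<gamma>)) Q)
            (stabilizer_stats (n l) (\<lambda>\<gamma>. g l (R #> \<gamma>)) Q)) \<longlonglongrightarrow> 0"
          if "finite Q" "Q \<subseteq> carrier G" for Q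
        proof (rule tendsto_tv_dist_on_stabilizer_stats_comp
            [where u = "\<lambda>\<gamma>. R #> \<gamma>" and f = f and g = g, OF \<open>finite Q\<close>])
          have "finite ((\<lambda>\<gamma>. R #> \<gamma>) ` Q) \<and> (\<lambda>\<gamma>. R #> \<gamma>) ` Q \<subseteq> carrier (G Mod R)"
            using that R.r_coset_in_FactGroup by blast
          then show "(\<lambda>l. tv_dist_on (Pow ((\<lambda>\<gamma>. R #> \<gamma>) ` Q))
              (stabilizer_stats (n l) (f l) ((\<lambda>\<gamma>. R #> \<gamma>) ` Q))
              (stabilizer_stats (n l) (g l) ((\<lambda>\<gamma>. R #> \<gamma>) ` Q))) \<longlonglongrightarrow> 0"
            by (rule tv [rule_format])
        qed
      next
        fix \<epsilon> :: "nat \<Rightarrow> real" and N h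
        assume h: "\<And>l. 0 < \<epsilon> l" "\<epsilon> \<longlonglongrightarrow> 0" "\<And>l. h l \<in> hom G (sym_group (N l))"
          "\<And>l. n l \<le> N l" "\<And>l. enat (N l) \<le> enat (n l) + \<nu> (\<epsilon> l) (n l)"
          "\<And>\<gamma>. \<gamma> \<in> carrier G \<Longrightarrow> (\<lambda>l. perm_dist (n l) (f l (R #> \<gamma>)) (h l \<gamma>)) \<longlonglongrightarrow> 0"
        \<comment> \<open>Evaluating at the representative recovers \<open>f l C\<close> exactly,
          because \<open>R #> coset_rep C = C\<close>.\<close>
        have "(\<lambda>l. perm_dist (n l) (f l C) (h l (coset_rep C))) \<longlonglongrightarrow> 0"
          if "C \<in> carrier (G Mod R)" for C
          using h(6) [of "coset_rep C"] that by (simp add: R.coset_rep)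
        then show ?thesis
          using h(1-5) descend
          by (intro exI [of _ \<epsilon>] exI [of _ N] exI [of _ "\<lambda>l C. h l (coset_rep C)"]) simp
      qed
    qed
  next
    assume rigid: "flexibly_BS_rigid \<nu> (G Mod R)"
    show "flexibly_BS_rigid \<nu> G"
      unfolding flexibly_BS_rigid_def
    proof (intro allI impI, elim conjE exE)
      fix n f g
      assume n: "\<forall>l. 1 \<le> n l" and f: "asymptotic_hom G n f"
        and g: "\<forall>l. g l \<in> hom G (sym_group (n l))"
        and tv: "\<forall>Q. finite Q \<and> Q \<subseteq> carrier G \<longrightarrow>
            (\<lambda>l. tv_dist_on (Pow Q) (stabilizer_stats (n l) (f l) Q)
                                    (stabilizer_stats (n l) (g l) Q)) \<longlonglongrightarrow> 0"
      \<comment> \<open>Since \<open>g l\<close> kills \<open>r\<close>, the statistics hypothesis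
        at the singleton \<open>{r}\<close> forces \<open>f l r\<close> towards the
        identity.\<close>
      have triv: "(\<lambda>l. perm_dist (n l) (f l r) id) \<longlonglongrightarrow> 0" if r: "r \<in> R" for r
      proof (rule tendsto_sandwich [OF _ _ tendsto_const tendsto_mult_right_zero])
        show "(\<lambda>l. tv_dist_on (Pow {r}) (stabilizer_stats (n l) (f l) {r})
                                       (stabilizer_stats (n l) (g l) {r})) \<longlonglongrightarrow> 0"
          using tv R.mem_carrier [OF r] by blast
        show "\<forall>\<^sub>F l in sequentially. perm_dist (n l) (f l r) id
            \<le> 2 * tv_dist_on (Pow {r}) (stabilizer_stats (n l) (f l) {r})
                                       (stabilizer_stats (n l) (g l) {r})"
          using n g kill [OF _ r] by (intro always_eventually allI perm_dist_id_le_tv_dist_on)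
            (auto simp: sym_group_one)
      qed (simp add: perm_dist_nonneg)
      show "\<exists>\<epsilon> N h. (\<forall>l. \<epsilon> l > 0) \<and> \<epsilon> \<longlonglongrightarrow> 0 \<and>
          (\<forall>l. h l \<in> hom G (sym_group (N l))) \<and>
          (\<forall>l. n l \<le> N l \<and> enat (N l) \<le> enat (n l) + \<nu> (\<epsilon> l) (n l)) \<and>
          (\<forall>\<gamma>\<in>carrier G. (\<lambda>l. perm_dist (n l) (f l \<gamma>) (h l \<gamma>)) \<longlonglongrightarrow> 0)"
      proof (rule flexibly_BS_rigidD [OF rigid])
        show "1 \<le> n l" for l
          using n by simp
        show "asymptotic_hom (G Mod R) n (\<lambda>l C. f l (coset_rep C))"
          by (rule R.asymptotic_hom_comp_coset_rep [OF f triv])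
        show "(\<lambda>C. g l (coset_rep C)) \<in> hom (G Mod R) (sym_group (n l))" for l
          using g by (intro descend) simp
        show "(\<lambda>l. tv_dist_on (Pow Q) (stabilizer_stats (n l) (\<lambda>C. f l (coset_rep C)) Q)
            (stabilizer_stats (n l) (\<lambda>C. g l (coset_rep C)) Q)) \<longlonglongrightarrow> 0"
          if "finite Q" "Q \<subseteq> carrier (G Mod R)" for Q
        proof (rule tendsto_tv_dist_on_stabilizer_stats_comp
            [where u = coset_rep and f = f and g = g, OF \<open>finite Q\<close>])
          have "finite (coset_rep ` Q) \<and> coset_rep ` Q \<subseteq> carrier G"
            using that R.coset_rep(1) by blast
          then show "(\<lambda>l. tv_dist_on (Pow (coset_rep ` Q))
              (stabilizer_stats (n l) (f l) (coset_rep ` Q))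
              (stabilizer_stats (n l) (g l) (coset_rep ` Q))) \<longlonglongrightarrow> 0"
            by (rule tv [rule_format])
        qed
      next
        fix \<epsilon> :: "nat \<Rightarrow> real" and N h
        assume h: "\<And>l. 0 < \<epsilon> l" "\<epsilon> \<longlonglongrightarrow> 0"
          "\<And>l. h l \<in> hom (G Mod R) (sym_group (N l))"
          "\<And>l. n l \<le> N l" "\<And>l. enat (N l) \<le> enat (n l) + \<nu> (\<epsilon> l) (n l)"
          "\<And>C. C \<in> carrier (G Mod R) \<Longrightarrow>
             (\<lambda>l. perm_dist (n l) (f l (coset_rep C)) (h l C)) \<longlonglongrightarrow> 0"
        \<comment> \<open>The detour goes through the representative of the coset of
          \<open>\<gamma>\<close>: it shares that coset with \<open>\<gamma>\<close>, so
          \<open>triv\<close> controls the first leg, and rigidity of the quotient controls the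
          second.\<close>
        have "(\<lambda>l. perm_dist (n l) (f l \<gamma>) (h l (R #> \<gamma>))) \<longlonglongrightarrow> 0" if "\<gamma> \<in> carrier G" for \<gamma>
        proof (rule perm_dist_tendsto_trans)
          have C: "R #> \<gamma> \<in> carrier (G Mod R)"
            using that by (rule R.r_coset_in_FactGroup)
          show "(\<lambda>l. perm_dist (n l) (f l \<gamma>) (f l (coset_rep (R #> \<gamma>)))) \<longlonglongrightarrow> 0"
            using that by (intro R.asymptotic_hom_r_coset_eq [OF f triv])
              (simp_all add: R.coset_rep [OF C])
          show "(\<lambda>l. perm_dist (n l) (f l (coset_rep (R #> \<gamma>))) (h l (R #> \<gamma>))) \<longlonglongrightarrow> 0"
            by (rule h(6) [OF C])
        qed
        then show ?thesis
          using h(1-5) lift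
          by (intro exI [of _ \<epsilon>] exI [of _ N] exI [of _ "\<lambda>l \<gamma>. h l (R #> \<gamma>)"]) simp
      qed
    qed
  qed
qed

theorem proposition1p23:
  fixes \<Gamma> :: "('a, 'b) monoid_scheme"
    and \<nu> :: "real \<Rightarrow> nat \<Rightarrow> enat"
  assumes "group \<Gamma>"
    and "finitely_generated_group \<Gamma>"
    and "\<And>\<epsilon> \<epsilon>' n. 0 < \<epsilon> \<Longrightarrow> \<epsilon> \<le> \<epsilon>' \<Longrightarrow> 1 \<le> n \<Longrightarrow> \<nu> \<epsilon> n \<le> \<nu> \<epsilon>' n"
  shows "(BS_rigid \<Gamma> \<longleftrightarrow> BS_rigid (\<Gamma> Mod finite_residual \<Gamma>)) \<and>
         (flexibly_BS_rigid \<nu> \<Gamma> \<longleftrightarrow> flexibly_BS_rigid \<nu> (\<Gamma> Mod finite_residual \<Gamma>))"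
  unfolding BS_rigid_def
  by (intro conjI group.flexibly_BS_rigid_Mod_finite_residual_iff [OF assms(1)])

end
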